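(* Let $n=rt$ with $t,r>1$, and let $f_1,f_2\in\mathcal{L}_{t,q}$ be scattered $q$-polynomials. Let $a_1,a_2,b_1,b_2\in\mathbb{F}_{q^t}$ with $b_1,b_2\neq 0$, and let $\omega_1,\omega_2\in\mathbb{F}_{q^n}$ be such that $\{1,\omega_1,\ldots,\omega_1^{r-1}\}$ and $\{1,\omega_2,\ldots,\omega_2^{r-1}\}$ are $\mathbb{F}_{q^t}$-bases of $\mathbb{F}_{q^n}$. Let $U_1=\{(f_1(x_0)-a_1x_0,\ b_1x_0+\sum_{i=1}^{r-1}x_i\omega_1^i) : x_0,\ldots,x_{r-1}\in\mathbb{F}_{q^t}\}$ and $U_2=\{(f_2(x_0)-a_2x_0,\ b_2x_0+\sum_{i=1}^{r-1}x_i\omega_2^i) : x_0,\ldots,x_{r-1}\in\mathbb{F}_{q^t}\}$. Then $U_1$ and $U_2$ are $\Gamma\mathrm{L}(2,q^n)$-equivalent if and only if the spaces $\overline{U}_{f_1}=\{(f_1(x_0)-a_1x_0,b_1x_0): x_0\in\mathbb{F}_{q^t}\}$ and $\overline{U}_{f_2}=\{(f_2(x_0)-a_2x_0,b_2x_0): x_0\in\mathbb{F}_{q^t}\}$ are $\Gamma\mathrm{L}(2,q^t)$-equivalent via an element $\phi\in\Gamma\mathrm{L}(2,q^t)$ that fixes the subspace $\langle(0,1)\rangle_{\mathbb{F}_{q^t}}$.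
   Context: $q$ is a prime power. $\mathcal{L}_{t,q}$ denotes the set of $q$-polynomials $f(x)=\sum_{i}c_ix^{q^i}$ with coefficients in $\mathbb{F}_{q^t}$. A polynomial $f\in\mathcal{L}_{t,q}$ is scattered if for every $m\in\mathbb{F}_{q^t}$, $\dim_{\mathbb{F}_q}\ker(f(x)-mx)\le 1$, the kernel taken in $\mathbb{F}_{q^t}$. The group $\Gamma\mathrm{L}(2,q^m)$ acts on $\mathbb{F}_{q^m}^2$ by $v\mapsto Mv^\rho$ with $M\in\mathrm{GL}(2,q^m)$, $\rho\in\mathrm{Aut}(\mathbb{F}_{q^m})$ applied entrywise; two $\mathbb{F}_q$-subspaces are $\Gamma\mathrm{L}(2,q^m)$-equivalent if one is mapped onto the other by such an element. *)

theory Defs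
  imports
    "HOL-Analysis.Analysis"
    "HOL-Computational_Algebra.Polynomial"
    "HOL-Number_Theory.Prime_Powers"
begin

text \<open>
  The tower of finite fields of orders \<open>q\<close>, \<open>q^t\<close>, \<open>q^n\<close> is given by three types
  \<open>'k\<close>, \<open>'m\<close>, \<open>'l\<close> of class \<^class>\<open>field\<close>, with inclusions represented by field embeddings
  \<open>\<iota> :: 'k \<Rightarrow> 'm\<close> and \<open>\<kappa> :: 'm \<Rightarrow> 'l\<close>.
\<close>

definition field_embedding :: "('a::field \<Rightarrow> 'b::field) \<Rightarrow> bool" where
  "field_embedding h \<longleftrightarrow>
     h 1 = 1 \<and> (\<forall>x y. h (x + y) = h x + h y) \<and> (\<forall>x y. h (x * y) = h x * h y)"

definition field_automorphism :: "('a::field \<Rightarrow> 'a) \<Rightarrow> bool" where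
  "field_automorphism \<rho> \<longleftrightarrow> field_embedding \<rho> \<and> bij \<rho>"

definition ext_scale :: "('a::field \<Rightarrow> 'b::field) \<Rightarrow> 'a \<Rightarrow> 'b \<Rightarrow> 'b" where
  "ext_scale h c x = h c * x"

lemma vector_space_ext_scale:
  assumes "field_embedding h"
  shows "vector_space (ext_scale h)"
  using assms unfolding field_embedding_def ext_scale_def
  by unfold_locales (auto simp: algebra_simps)

definition basis_over :: "('a::field \<Rightarrow> 'b::field) \<Rightarrow> 'b set \<Rightarrow> bool" where
  "basis_over h B \<longleftrightarrow>
     \<not> module.dependent (ext_scale h) B \<and> module.span (ext_scale h) B = UNIV"

definition q_polynomials :: "nat \<Rightarrow> 'a::field poly set" where
  "q_polynomials q = {f. \<exists>c d. f = (\<Sum>i\<le>d. monom (c i) (q ^ i))}"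

definition scattered :: "('k::field \<Rightarrow> 'm::field) \<Rightarrow> 'm poly \<Rightarrow> bool" where
  "scattered \<iota> f \<longleftrightarrow>
     (\<forall>m. vector_space.dim (ext_scale \<iota>) {x. poly f x - m * x = 0} \<le> 1)"

definition GammaL2 :: "('a::field ^ 2 \<Rightarrow> 'a ^ 2) set" where
  "GammaL2 = {\<phi>. \<exists>(M :: 'a ^ 2 ^ 2) \<rho>. invertible M \<and> field_automorphism \<rho> \<and>
                   \<phi> = (\<lambda>v. M *v (\<chi> i. \<rho> (v $ i)))}"

definition U_space ::
  "('m::field \<Rightarrow> 'l::field) \<Rightarrow> nat \<Rightarrow> 'm poly \<Rightarrow> 'm \<Rightarrow> 'm \<Rightarrow> 'l \<Rightarrow> ('l ^ 2) set" where
  "U_space \<kappa> r f a b \<omega> =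
     {vector [\<kappa> (poly f (x 0) - a * x 0),
              \<kappa> (b * x 0) + (\<Sum>i = 1..r - 1. \<kappa> (x i) * \<omega> ^ i)] | x :: nat \<Rightarrow> 'm. True}"

definition Ubar_space :: "'m::field poly \<Rightarrow> 'm \<Rightarrow> 'm \<Rightarrow> ('m ^ 2) set" where
  "Ubar_space f a b = {vector [poly f x - a * x, b * x] | x. True}"

end

theory Submission
  imports Defs "HOL-Algebra.Multiplicative_Group"
begin

text \<open>
  Write \<open>F\<close>, \<open>L\<close> for the fields of order \<open>q^t\<close>, \<open>q^n\<close>, let \<open>\<pi>\<^sub>i : L \<rightarrow> F\<close> be the
  \<open>F\<close>-linear coordinate of \<open>1\<close> in the basis of powers of \<open>\<omega>\<^sub>i\<close>, and put
  \<open>h\<^sub>i y = f\<^sub>i (y / b\<^sub>i) - a\<^sub>i y / b\<^sub>i\<close>.  Then \<open>U\<^sub>i\<close> consists of the pairs \<open>(h\<^sub>i (\<pi>\<^sub>i l), l)\<close> with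
  \<open>l \<in> L\<close>, and the space attached to \<open>f\<^sub>i\<close> consists of the pairs \<open>(h\<^sub>i y, y)\<close> with \<open>y \<in> F\<close>.

  Suppose \<open>M = ((\<alpha>, \<beta>), (\<gamma>, \<delta>))\<close> with automorphism \<open>\<sigma>\<close> maps \<open>U\<^sub>1\<close> onto \<open>U\<^sub>2\<close>.  The point
  \<open>\<langle>(0, 1)\<rangle>\<close> meets \<open>U\<^sub>1\<close> in at least \<open>|ker \<pi>\<^sub>1| \<ge> q^t\<close> vectors, whereas by scatteredness every
  other point meets \<open>U\<^sub>2\<close> in at most \<open>q\<close> vectors; hence \<open>\<beta> = 0\<close>.  Comparing first coordinates
  gives \<open>\<alpha> \<in> F\<close>, and \<open>\<pi>\<^sub>2 (\<delta> \<sigma> l)\<close> for \<open>l \<in> ker \<pi>\<^sub>1\<close> ranges over an \<open>F\<close>-subspace of \<open>F\<close> on which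
  \<open>h\<^sub>2\<close> vanishes, so it is \<open>0\<close>.  Then \<open>((\<alpha>, 0), (\<pi>\<^sub>2 \<gamma>, \<pi>\<^sub>2 \<delta>))\<close> with \<open>\<sigma>\<close> restricted to \<open>F\<close>
  is the required equivalence.

  Conversely, given \<open>((\<alpha>, 0), (\<gamma>, \<delta>))\<close> and \<open>\<rho>\<close> over \<open>F\<close>, extend \<open>\<rho>\<close> to an automorphism \<open>\<sigma>\<close> of
  \<open>L\<close>.  Every \<open>F\<close>-linear functional on \<open>L\<close> has the form \<open>l \<mapsto> \<pi>\<^sub>2 (d l)\<close>, so some \<open>d\<close> satisfies
  \<open>\<pi>\<^sub>2 (d \<sigma> l) = \<delta> \<rho> (\<pi>\<^sub>1 l)\<close> for all \<open>l\<close>, and \<open>((\<alpha>, 0), (\<gamma>, d))\<close> with \<open>\<sigma>\<close> maps \<open>U\<^sub>1\<close> onto \<open>U\<^sub>2\<close>.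
\<close>

section \<open>Elementary properties of field embeddings\<close>

lemma field_embedding_simps:
  fixes h :: "'a::field \<Rightarrow> 'b::field"
  assumes "field_embedding h"
  shows "h 0 = 0" "h 1 = 1" "h (x + y) = h x + h y" "h (x * y) = h x * h y"
    "h (- x) = - h x" "h (x - y) = h x - h y" "h (x ^ n) = h x ^ n" "h (of_nat n) = of_nat n"
proof -
  have add: "h (x + y) = h x + h y" and mult: "h (x * y) = h x * h y" and one: "h 1 = 1" for x y
    using assms by (auto simp: field_embedding_def)
  have zero: "h 0 = 0"
    using add[of 0 0] by (metis add.right_neutral add_left_cancel)
  have neg: "h (- x) = - h x" for x
    using add[of x "- x"] zero by (simp add: eq_neg_iff_add_eq_0 add.commute)
  show "h (x + y) = h x + h y" "h (x * y) = h x * h y" "h 1 = 1" "h 0 = 0" "h (- x) = - h x"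
    by (fact add mult one zero neg)+
  show "h (x - y) = h x - h y"
    using add[of x "- y"] neg by simp
  show "h (x ^ n) = h x ^ n"
    by (induction n) (auto simp: mult one)
  show "h (of_nat n) = of_nat n"
    by (induction n) (auto simp: add one zero)
qed

lemma field_embedding_eq_0_iff:
  fixes h :: "'a::field \<Rightarrow> 'b::field"
  assumes "field_embedding h"
  shows "h x = 0 \<longleftrightarrow> x = 0"
proof
  assume "h x = 0"
  show "x = 0"
  proof (rule ccontr)
    assume "x \<noteq> 0"
    then have "h x * h (inverse x) = 1"
      using field_embedding_simps(4)[OF assms, of x "inverse x"] field_embedding_simps(2)[OF assms]
      by simp
    then show False
      using \<open>h x = 0\<close> by simp
  qed
qed (simp add: field_embedding_simps[OF assms])

lemma inj_field_embedding:
  fixes h :: "'a::field \<Rightarrow> 'b::field"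
  assumes "field_embedding h"
  shows "inj h"
proof (rule injI)
  fix x y assume "h x = h y"
  then have "h (x - y) = 0"
    by (simp add: field_embedding_simps[OF assms])
  then show "x = y"
    by (simp add: field_embedding_eq_0_iff[OF assms])
qed

lemma field_automorphismI_finite:
  fixes h :: "'a::{field,finite} \<Rightarrow> 'a"
  assumes "field_embedding h"
  shows "field_automorphism h"
  using inj_field_embedding[OF assms] assms finite_UNIV_inj_surj[of h]
  by (simp add: field_automorphism_def bij_def)

section \<open>Automorphisms of finite fields\<close>

text \<open>The type-class field is repackaged as the record \<open>R\<close>, so that cyclicity of
  the multiplicative group and the theorem on element orders from HOL-Algebra apply to it.\<close>

lemma finite_field_generator:
  obtains g :: "'a::{field,finite}" where "g \<noteq> 0" "\<And>x. x \<noteq> 0 \<Longrightarrow> \<exists>i::nat. x = g ^ i"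
    "\<And>x::'a. x \<noteq> 0 \<Longrightarrow> x ^ (CARD('a) - 1) = 1"
proof -
  define R :: "'a ring" where
    "R = \<lparr>carrier = UNIV, monoid.mult = (*), one = 1, ring.zero = 0, add = (+)\<rparr>"
  have "\<exists>y. x + y = 0 \<and> y + x = 0" for x :: 'a
    by (rule exI[of _ "- x"]) simp
  moreover have "\<exists>y. x * y = 1 \<and> y * x = 1" if "x \<noteq> 0" for x :: 'a
    by (rule exI[of _ "inverse x"]) (use that in simp)
  ultimately interpret R: field R
    by unfold_locales
      (auto simp: R_def algebra_simps Units_def)
  have pow: "x [^]\<^bsub>R\<^esub> (i::nat) = x ^ i" for x i
    by (induction i) (auto simp: R_def nat_pow_def mult.commute)
  have carrier: "carrier (mult_of R) = {x. x \<noteq> 0}"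
    by (auto simp: R_def mult_of_def)
  have "finite (carrier R)"
    by (simp add: R_def)
  from R.finite_field_mult_group_has_gen[OF this] obtain g :: 'a
    where g: "g \<in> {x. x \<noteq> 0}" "{x. x \<noteq> 0} = {g ^ i | i::nat. i \<in> UNIV}"
    unfolding carrier pow ..
  have order: "order (mult_of R) = CARD('a) - 1"
    by (simp add: order_def Compl_eq_Diff_UNIV R_def)
  show thesis
  proof
    show "g \<noteq> 0"
      using g(1) by simp
    show "\<exists>i::nat. x = g ^ i" if "x \<noteq> 0" for x
      using g(2) that by blast
    show "x ^ (CARD('a) - 1) = 1" if "x \<noteq> 0" for x :: 'a
      using group.pow_order_eq_1[OF R.field_mult_group, of x] that
      unfolding order nat_pow_mult_of pow carrier by (simp add: R_def)
  qed
qed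

lemma finite_field_power_card:
  fixes x :: "'a::{field,finite}"
  shows "x ^ CARD('a) = x"
proof (cases "x = 0")
  case False
  then have "x ^ (CARD('a) - 1) * x = x"
    by (metis finite_field_generator mult_1)
  then show ?thesis
    using power_minus_mult[of "CARD('a)" x] by (simp only: zero_less_card_finite)
qed (simp add: power_0_left)

text \<open>An automorphism is determined by the image of a generator \<open>g\<close>, which is
  itself a power of \<open>g\<close>. The bound \<open>s < CARD('a)\<close> later keeps the degree
  of a polynomial below the number of its roots.\<close>

lemma field_automorphism_eq_power:
  fixes \<rho> :: "'a::{field,finite} \<Rightarrow> 'a"
  assumes "field_automorphism \<rho>"
  obtains s where "0 < s" "s < CARD('a)" "\<And>x. \<rho> x = x ^ s"
proof -
  obtain g :: 'a where g: "g \<noteq> 0" "\<And>x. x \<noteq> 0 \<Longrightarrow> \<exists>i::nat. x = g ^ i"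
    "\<And>x::'a. x \<noteq> 0 \<Longrightarrow> x ^ (CARD('a) - 1) = 1"
    by (rule finite_field_generator) blast
  have emb: "field_embedding \<rho>"
    using assms by (simp add: field_automorphism_def)
  let ?N = "CARD('a) - 1"
  have "{0::'a, 1} \<subseteq> UNIV" by simp
  from card_mono[OF _ this] have N: "?N > 0" by simp
  obtain i where i: "\<rho> g = g ^ i"
    using g by (metis emb field_embedding_eq_0_iff)
  have red: "g ^ i = g ^ (i mod ?N)"
    by (metis (no_types) div_mult_mod_eq g(1,3) mult_1 mult.commute power_add power_mult power_one)
  \<comment> \<open>A reduced exponent 0 is replaced by \<open>?N\<close>, which gives the same
    power of \<open>g\<close>; positivity is required for \<open>0 ^ s = 0\<close>.\<close>
  obtain s where s: "0 < s" "s \<le> ?N" "\<rho> g = g ^ s"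
  proof (cases "i mod ?N = 0")
    case True
    then have "\<rho> g = g ^ ?N"
      using i red g by simp
    then show ?thesis using that[of ?N] N by simp
  next
    case False
    then show ?thesis using that[of "i mod ?N"] N i red by simp
  qed
  have "\<rho> x = x ^ s" for x
  proof (cases "x = 0")
    case True
    then show ?thesis using s by (simp add: field_embedding_simps[OF emb] power_0_left)
  next
    case False
    then obtain j where "x = g ^ j" using g by blast
    then show ?thesis
      by (simp add: field_embedding_simps[OF emb] s(3) flip: power_mult) (simp add: mult.commute)
  qed
  then show ?thesis
    using that[of s] s N by simp
qed

text \<open>
  An automorphism is a power map \<open>x \<mapsto> x ^ s\<close> with \<open>s < |F|\<close>, so its additivity is a polynomial
  identity, which amounts to the vanishing of the intermediate binomial coefficients.  These
  then vanish in every extension field as well, where the same power map is thus additive.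
\<close>

lemma additive_power_binomial_eq_0:
  fixes j :: nat
  assumes "\<And>x y :: 'a::{field,finite}. (x + y) ^ s = x ^ s + y ^ s" "s < CARD('a)"
    and "0 < j" "j < s"
  shows "of_nat (s choose j) = (0::'a)"
proof -
  \<comment> \<open>The middle terms of the binomial expansion of (X + 1)^s. Additivity with
    \<open>y = 1\<close> makes every field element a root, more roots than the degree permits for a
    nonzero polynomial.\<close>
  define P :: "'a poly" where "P = (\<Sum>j\<in>{0<..<s}. Polynomial.monom (of_nat (s choose j)) j)"
  have "poly P x = 0" for x
  proof -
    have "{..s} = insert 0 (insert s {0<..<s})"
      using assms by auto
    then have "(x + 1) ^ s = 1 + x ^ s + poly P x"
      using assms(3,4) unfolding binomial_ring
      by (simp add: P_def poly_sum poly_monom)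
    then show ?thesis
      using assms(1)[of x 1] by simp
  qed
  then have roots: "{x. poly P x = 0} = UNIV" by simp
  have "degree P \<le> s"
    unfolding P_def
    by (rule degree_sum_le) (auto intro: order.trans[OF degree_monom_le])
  then have "P = 0"
    using card_poly_roots_bound[of P] assms(2) unfolding roots by linarith
  then have "Polynomial.coeff P j = 0" by simp
  then show ?thesis
    using assms(3,4) by (simp add: P_def coeff_sum coeff_monom)
qed

lemma field_automorphism_extends:
  fixes \<kappa> :: "'m::{field,finite} \<Rightarrow> 'l::{field,finite}"
  assumes \<kappa>: "field_embedding \<kappa>" and \<rho>: "field_automorphism \<rho>"
  obtains \<sigma> where "field_automorphism \<sigma>" "\<And>x. \<sigma> (\<kappa> x) = \<kappa> (\<rho> x)"
proof -
  obtain s where s: "0 < s" "s < CARD('m)" "\<And>x. \<rho> x = x ^ s"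
    using field_automorphism_eq_power[OF \<rho>] by blast
  have emb: "field_embedding \<rho>"
    using \<rho> by (simp add: field_automorphism_def)
  have "(x + y) ^ s = x ^ s + y ^ s" for x y :: 'm
    using field_embedding_simps(3)[OF emb] by (simp add: s(3))
  then have "of_nat (s choose j) = (0::'m)" if "0 < j" "j < s" for j
    by (rule additive_power_binomial_eq_0) (use that s in auto)
  then have binom: "of_nat (s choose j) = (0::'l)" if "0 < j" "j < s" for j
    using that by (metis \<kappa> field_embedding_simps(1,8))
  have "{..s} = insert 0 (insert s {0<..<s})"
    using s by auto
  then have "(x + y) ^ s = x ^ s + y ^ s" for x y :: 'l
    using s unfolding binomial_ring by (simp add: binom)
  then have "field_embedding (\<lambda>x::'l. x ^ s)"
    by (simp add: field_embedding_def power_mult_distrib)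
  then show ?thesis
    using that[of "\<lambda>x. x ^ s"] field_automorphismI_finite[of "\<lambda>x::'l. x ^ s"]
    by (simp add: s(3) field_embedding_simps[OF \<kappa>])
qed

text \<open>With Q the order of the smaller field, its image consists of all solutions of x^Q = x:
  it lies among them and there are at most Q. Every automorphism preserves this equation, hence the
  subfield.\<close>

lemma field_automorphism_restricts:
  fixes \<kappa> :: "'m::{field,finite} \<Rightarrow> 'l::{field,finite}"
  assumes \<kappa>: "field_embedding \<kappa>" and \<sigma>: "field_automorphism \<sigma>"
  obtains \<rho> where "field_automorphism \<rho>" "\<And>x. \<sigma> (\<kappa> x) = \<kappa> (\<rho> x)"
proof -
  note \<kappa>_simps = field_embedding_simps[OF \<kappa>]
  have emb: "field_embedding \<sigma>"
    using \<sigma> by (simp add: field_automorphism_def)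
  note \<sigma>_simps = field_embedding_simps[OF emb]
  let ?Q = "CARD('m)"
  define P :: "'l poly" where "P = Polynomial.monom 1 ?Q - Polynomial.monom 1 1"
  have "{0::'m, 1} \<subseteq> UNIV" by simp
  from card_mono[OF _ this] have Q: "?Q > 1" by simp
  have roots: "{x. poly P x = 0} = {x. x ^ ?Q = x}"
    by (simp add: P_def poly_monom)
  have "Polynomial.coeff P ?Q = 1"
    using Q by (simp add: P_def coeff_monom)
  then have "P \<noteq> 0" by auto
  moreover have "degree P \<le> ?Q"
    unfolding P_def using Q by (intro degree_diff_le) (auto simp: degree_monom_eq)
  ultimately have "card {x::'l. x ^ ?Q = x} \<le> ?Q"
    using card_poly_roots_bound[of P] unfolding roots by linarith
  moreover have "card (range \<kappa>) = ?Q"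
    by (rule card_image) (rule inj_field_embedding[OF \<kappa>])
  moreover have "range \<kappa> \<subseteq> {x. x ^ ?Q = x}"
    by (auto simp: finite_field_power_card simp flip: \<kappa>_simps)
  ultimately have range: "range \<kappa> = {x. x ^ ?Q = x}"
    by (intro card_seteq) auto
  have "\<sigma> (\<kappa> x) \<in> range \<kappa>" for x
    unfolding range by (simp add: finite_field_power_card flip: \<kappa>_simps \<sigma>_simps)
  then have "\<forall>x. \<exists>y. \<sigma> (\<kappa> x) = \<kappa> y"
    by blast
  then obtain \<rho> where \<rho>: "\<And>x. \<sigma> (\<kappa> x) = \<kappa> (\<rho> x)"
    by metis
  have "field_embedding \<rho>"
    unfolding field_embedding_def
    by (intro conjI allI; rule injD[OF inj_field_embedding[OF \<kappa>]])
      (simp_all add: \<kappa>_simps \<sigma>_simps flip: \<rho>)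
  then show ?thesis
    using that \<rho> field_automorphismI_finite by blast
qed

section \<open>Linear functionals of a finite field extension\<close>

definition functional_over :: "('a::field \<Rightarrow> 'b::field) \<Rightarrow> ('b \<Rightarrow> 'a) \<Rightarrow> bool" where
  "functional_over \<kappa> \<pi> \<longleftrightarrow>
     (\<forall>x y. \<pi> (x + y) = \<pi> x + \<pi> y) \<and> (\<forall>c x. \<pi> (\<kappa> c * x) = c * \<pi> x)"

lemma functional_over_simps:
  assumes "functional_over \<kappa> \<pi>"
  shows "\<pi> (x + y) = \<pi> x + \<pi> y" "\<pi> (\<kappa> c * x) = c * \<pi> x" "\<pi> (x * \<kappa> c) = c * \<pi> x"
    "\<pi> 0 = 0" "\<pi> (- x) = - \<pi> x" "\<pi> (x - y) = \<pi> x - \<pi> y"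
proof -
  have add: "\<pi> (x + y) = \<pi> x + \<pi> y" and scale: "\<pi> (\<kappa> c * x) = c * \<pi> x" for x y c
    using assms by (auto simp: functional_over_def)
  have zero: "\<pi> 0 = 0"
    using add[of 0 0] by (metis add.right_neutral add_left_cancel)
  have neg: "\<pi> (- x) = - \<pi> x" for x
    using add[of x "- x"] zero by (simp add: eq_neg_iff_add_eq_0 add.commute)
  show "\<pi> (x + y) = \<pi> x + \<pi> y" "\<pi> (\<kappa> c * x) = c * \<pi> x" "\<pi> 0 = 0" "\<pi> (- x) = - \<pi> x"
    by (fact add scale zero neg)+
  show "\<pi> (x * \<kappa> c) = c * \<pi> x"
    using scale by (simp add: mult.commute)
  show "\<pi> (x - y) = \<pi> x - \<pi> y"
    using add[of x "- y"] neg by simp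
qed

lemma functional_over_sum:
  assumes "functional_over \<kappa> \<pi>"
  shows "\<pi> (\<Sum>i\<in>I. \<kappa> (x i) * e i) = (\<Sum>i\<in>I. x i * \<pi> (e i))"
  by (induction I rule: infinite_finite_induct) (auto simp: functional_over_simps[OF assms])

text \<open>A counting argument. A functional is determined by its values on the r spanning elements
  \<open>e i\<close>, so there are at most |F|^r = |L| of them, while the maps l \<mapsto> \<pi> (c
  l) already provide |L| different ones.\<close>

lemma functional_over_eq_mult:
  fixes \<kappa> :: "'m::{field,finite} \<Rightarrow> 'l::{field,finite}" and e :: "nat \<Rightarrow> 'l"
  assumes span: "\<And>l. \<exists>x. l = (\<Sum>i<r. \<kappa> (x i) * e i)"
    and card: "CARD('l) = CARD('m) ^ r"
    and \<pi>: "functional_over \<kappa> \<pi>" "\<pi> 1 \<noteq> 0" and \<eta>: "functional_over \<kappa> \<eta>"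
  obtains c where "\<And>l. \<eta> l = \<pi> (c * l)"
proof -
  let ?H = "{\<eta>. functional_over \<kappa> \<eta>}"
  let ?E = "\<lambda>\<eta>. \<lambda>i\<in>{..<r}. \<eta> (e i)"
  let ?T = "PiE {..<r} (\<lambda>_. UNIV) :: (nat \<Rightarrow> 'm) set"
  have "inj_on ?E ?H"
  proof (rule inj_onI)
    fix \<eta> \<theta> assume "\<eta> \<in> ?H" "\<theta> \<in> ?H" and eq: "?E \<eta> = ?E \<theta>"
    then have fn: "functional_over \<kappa> \<eta>" "functional_over \<kappa> \<theta>" by auto
    have e: "\<eta> (e i) = \<theta> (e i)" if "i < r" for i
      using fun_cong[OF eq, of i] that by simp
    show "\<eta> = \<theta>"
    proof
      fix l
      obtain x where l: "l = (\<Sum>i<r. \<kappa> (x i) * e i)"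
        using span by blast
      show "\<eta> l = \<theta> l"
        unfolding l functional_over_sum[OF fn(1)] functional_over_sum[OF fn(2)]
        by (intro sum.cong) (auto simp: e)
    qed
  qed
  moreover have "?E ` ?H \<subseteq> ?T"
    by (auto split: if_split_asm)
  moreover have "finite ?T" by (simp add: finite_PiE)
  ultimately have "card ?H \<le> card ?T"
    by (rule card_inj_on_le)
  also have "card ?T = CARD('l)"
    by (simp add: card_PiE card)
  finally have H: "card ?H \<le> CARD('l)" .
  define m where "m = (\<lambda>c l. \<pi> (c * l))"
  have "inj m"
  proof (rule injI, rule ccontr)
    fix c d assume "m c = m d" "c \<noteq> d"
    then have "\<pi> (c * l) = \<pi> (d * l)" for l
      by (auto simp: m_def dest: fun_cong)
    then have "\<pi> ((c - d) * l) = 0" for l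
      by (simp add: left_diff_distrib functional_over_simps[OF \<pi>(1)])
    \<comment> \<open>This choice of l turns the identity into \<open>\<pi> 1 = 0\<close>.\<close>
    from this[of "inverse (c - d)"] show False
      using \<open>c \<noteq> d\<close> \<pi>(2) by simp
  qed
  then have "card (range m) = CARD('l)"
    by (rule card_image)
  moreover have "range m \<subseteq> ?H"
    by (auto simp: m_def functional_over_def functional_over_simps[OF \<pi>(1)] distrib_left
        mult.left_commute[of _ "\<kappa> _"])
  ultimately have "range m = ?H"
    using H by (intro card_seteq) auto
  then obtain c where "\<eta> = m c"
    using \<eta> by blast
  then show ?thesis
    using that by (simp add: m_def)
qed

text \<open>The basis is given as a set, so different exponents might a priori yield the same power.
  Spanning makes the evaluation of r-tuples surjective onto L, and |L| = |F|^r then makes it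
  injective, so the coefficient of 1 is well defined.\<close>

lemma basis_over_constant_coordinate:
  fixes \<kappa> :: "'m::{field,finite} \<Rightarrow> 'l::{field,finite}" and \<omega> :: 'l
  assumes \<kappa>: "field_embedding \<kappa>" and card: "CARD('l) = CARD('m) ^ r" and "r > 0"
    and basis: "basis_over \<kappa> ((\<lambda>i. \<omega> ^ i) ` {0..r - 1})"
  obtains \<pi> where "functional_over \<kappa> \<pi>"
    "\<And>x. \<pi> (\<Sum>i<r. \<kappa> (x i) * \<omega> ^ i) = x 0"
    "\<And>l. \<exists>x. l = (\<Sum>i<r. \<kappa> (x i) * \<omega> ^ i)"
proof -
  interpret vector_space "ext_scale \<kappa>"
    by (rule vector_space_ext_scale[OF \<kappa>])
  note \<kappa>_simps = field_embedding_simps[OF \<kappa>]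
  define ev where "ev x = (\<Sum>i<r. \<kappa> (x i) * \<omega> ^ i)" for x
  let ?S = "(\<lambda>i. \<omega> ^ i) ` {..<r}"
  let ?T = "PiE {..<r} (\<lambda>_. UNIV) :: (nat \<Rightarrow> 'm) set"
  have S: "(\<lambda>i. \<omega> ^ i) ` {0..r - 1} = ?S"
    using \<open>r > 0\<close> by (intro image_cong) auto
  have ev_restrict: "ev (restrict x {..<r}) = ev x" for x
    by (simp add: ev_def)
  have surj: "\<exists>x. l = ev x" for l
  proof -
    have "\<forall>v\<in>?S. \<exists>i<r. v = \<omega> ^ i" by auto
    \<comment> \<open>\<open>k\<close> selects one exponent for each element of the spanning set;
      exponents that are not selected receive coefficient 0 in \<open>x\<close> below.\<close>
    then obtain k where k: "\<And>v. v \<in> ?S \<Longrightarrow> k v < r \<and> v = \<omega> ^ k v"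
      by metis
    then have inj: "inj_on k ?S"
      by (intro inj_onI) metis
    have "l \<in> span ?S"
      using basis unfolding basis_over_def S by simp
    then obtain u where l: "l = (\<Sum>v\<in>?S. \<kappa> (u v) * v)"
      by (auto simp: span_finite ext_scale_def)
    define x where "x i = (if i \<in> k ` ?S then u (\<omega> ^ i) else 0)" for i
    have "ev x = (\<Sum>i\<in>k ` ?S. \<kappa> (x i) * \<omega> ^ i)"
      unfolding ev_def using k
      by (intro sum.mono_neutral_right) (auto simp: x_def \<kappa>_simps)
    also have "\<dots> = (\<Sum>v\<in>?S. \<kappa> (x (k v)) * \<omega> ^ k v)"
      by (simp add: sum.reindex[OF inj])
    also have "\<dots> = l"
      unfolding l using k by (intro sum.cong) (auto simp: x_def)
    finally show ?thesis by metis
  qed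
  have "ev ` ?T = UNIV"
  proof -
    have "l \<in> ev ` ?T" for l
    proof -
      obtain x where "l = ev x" using surj by blast
      then have "l = ev (restrict x {..<r})" by (simp add: ev_restrict)
      then show ?thesis
        by (rule image_eqI[of _ ev]) (simp add: restrict_PiE_iff)
    qed
    then show ?thesis by auto
  qed
  then have inj: "inj_on ev ?T"
    by (intro eq_card_imp_inj_on) (auto simp: finite_PiE card_PiE card)
  have uniq: "x 0 = y 0" if "ev x = ev y" for x y
  proof -
    have "restrict x {..<r} = restrict y {..<r}"
      by (rule inj_onD[OF inj]) (use that in \<open>auto simp: ev_restrict\<close>)
    from fun_cong[OF this, of 0] show ?thesis
      using \<open>r > 0\<close> by simp
  qed
  define \<pi> where "\<pi> l = (SOME x. l = ev x) 0" for l
  have \<pi>: "\<pi> (ev x) = x 0" for x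
    unfolding \<pi>_def by (rule uniq) (metis (mono_tags) someI)
  have "functional_over \<kappa> \<pi>"
    unfolding functional_over_def
  proof (intro conjI allI)
    fix k l
    obtain x y where xy: "k = ev x" "l = ev y" using surj by blast
    have "ev x + ev y = ev (\<lambda>i. x i + y i)"
      by (simp add: ev_def \<kappa>_simps distrib_right sum.distrib)
    then show "\<pi> (k + l) = \<pi> k + \<pi> l"
      by (simp add: xy \<pi>)
  next
    fix c l
    obtain x where x: "l = ev x" using surj by blast
    have "\<kappa> c * ev x = ev (\<lambda>i. c * x i)"
      by (simp add: ev_def \<kappa>_simps sum_distrib_left mult.assoc)
    then show "\<pi> (\<kappa> c * l) = c * \<pi> l"
      by (simp add: x \<pi>)
  qed
  then show ?thesis
    using that[of \<pi>] \<pi> surj by (simp add: ev_def)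
qed

section \<open>Semilinear maps of the plane\<close>

lemma mem_GammaL2_iff:
  fixes \<phi> :: "'a::field ^ 2 \<Rightarrow> 'a ^ 2"
  shows "\<phi> \<in> GammaL2 \<longleftrightarrow> (\<exists>\<alpha> \<beta> \<gamma> \<delta> \<rho>. \<alpha> * \<delta> - \<beta> * \<gamma> \<noteq> 0 \<and> field_automorphism \<rho> \<and>
    \<phi> = (\<lambda>v. vector [\<alpha> * \<rho> (v $ 1) + \<beta> * \<rho> (v $ 2), \<gamma> * \<rho> (v $ 1) + \<delta> * \<rho> (v $ 2)]))"
    (is "_ \<longleftrightarrow> ?R")
proof
  assume "\<phi> \<in> GammaL2"
  then obtain M :: "'a ^ 2 ^ 2" and \<rho>
    where M: "invertible M" "field_automorphism \<rho>" "\<phi> = (\<lambda>v. M *v (\<chi> i. \<rho> (v $ i)))"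
    by (auto simp: GammaL2_def)
  have "M $ 1 $ 1 * M $ 2 $ 2 - M $ 1 $ 2 * M $ 2 $ 1 \<noteq> 0"
    using M(1) by (simp add: invertible_det_nz det_2)
  moreover have "\<phi> = (\<lambda>v. vector [M $ 1 $ 1 * \<rho> (v $ 1) + M $ 1 $ 2 * \<rho> (v $ 2),
      M $ 2 $ 1 * \<rho> (v $ 1) + M $ 2 $ 2 * \<rho> (v $ 2)])"
    unfolding M(3)
    by (auto simp: fun_eq_iff vec_eq_iff forall_2 matrix_vector_mult_def sum_2)
  ultimately show ?R
    using M(2) by blast
next
  assume ?R
  then obtain \<alpha> \<beta> \<gamma> \<delta> \<rho> where *: "\<alpha> * \<delta> - \<beta> * \<gamma> \<noteq> 0" "field_automorphism \<rho>"
    "\<phi> = (\<lambda>v. vector [\<alpha> * \<rho> (v $ 1) + \<beta> * \<rho> (v $ 2), \<gamma> * \<rho> (v $ 1) + \<delta> * \<rho> (v $ 2)])"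
    by blast
  define M :: "'a ^ 2 ^ 2" where "M = vector [vector [\<alpha>, \<beta>], vector [\<gamma>, \<delta>]]"
  have "invertible M"
    using *(1) by (simp add: invertible_det_nz det_2 M_def)
  moreover have "\<phi> = (\<lambda>v. M *v (\<chi> i. \<rho> (v $ i)))"
    unfolding *(3)
    by (auto simp: fun_eq_iff vec_eq_iff forall_2 matrix_vector_mult_def sum_2 M_def)
  ultimately show "\<phi> \<in> GammaL2"
    using *(2) by (auto simp: GammaL2_def)
qed

lemma inj_GammaL2:
  assumes "\<phi> \<in> GammaL2"
  shows "inj \<phi>"
proof -
  obtain M \<rho> where M: "invertible M" "field_automorphism \<rho>"
    "\<phi> = (\<lambda>v. M *v (\<chi> i. \<rho> (v $ i)))"
    using assms by (auto simp: GammaL2_def)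
  have "inj \<rho>"
    using M(2) by (simp add: field_automorphism_def bij_def)
  then have "inj (\<lambda>v. \<chi> i::2. \<rho> (v $ i))"
    by (auto simp: inj_def vec_eq_iff)
  from inj_compose[OF inj_matrix_vector_mult[OF M(1)] this] show ?thesis
    by (simp add: M(3) o_def)
qed

text \<open>Injectivity and finiteness reduce equality of the image to an inclusion, so only one
  direction ever needs computing.\<close>

lemma GammaL2_image_eqI:
  fixes A B :: "('a::{field,finite} ^ 2) set"
  assumes "\<phi> \<in> GammaL2" "\<phi> ` A \<subseteq> B" "card A = card B"
  shows "\<phi> ` A = B"
  using assms(2)
  by (rule card_subset_eq[rotated])
    (use assms(3) card_image[OF inj_on_subset[OF inj_GammaL2[OF assms(1)] subset_UNIV]] in auto)

lemma span_vertical: "vec.span {vector [0, 1] :: 'a::field ^ 2} = {v. v $ 1 = 0}"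
proof (intro equalityI subsetI)
  fix v :: "'a ^ 2"
  assume "v \<in> {v. v $ 1 = 0}"
  then have "v = v $ 2 *s vector [0, 1]"
    by (auto simp: vec_eq_iff forall_2)
  then show "v \<in> vec.span {vector [0, 1]}"
    unfolding vec.span_singleton by blast
qed (auto simp: vec.span_singleton)

lemma card_range_graph:
  fixes h :: "'a::{field,finite} \<Rightarrow> 'a"
  shows "card (range (\<lambda>y. vector [h y, y] :: 'a ^ 2)) = CARD('a)"
  by (rule card_image) (auto simp: inj_def vec_eq_iff forall_2)

section \<open>Transfer between the two planes\<close>

lemma equivalence_extends:
  fixes \<kappa> :: "'m::{field,finite} \<Rightarrow> 'l::{field,finite}"
  assumes \<kappa>: "field_embedding \<kappa>"
    and \<pi>\<^sub>1: "functional_over \<kappa> \<pi>\<^sub>1" "\<pi>\<^sub>1 1 = 1"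
    and \<pi>\<^sub>2: "functional_over \<kappa> \<pi>\<^sub>2" "\<pi>\<^sub>2 1 = 1"
    and dual: "\<And>\<eta>. functional_over \<kappa> \<eta> \<Longrightarrow> \<exists>c. \<forall>l. \<eta> l = \<pi>\<^sub>2 (c * l)"
    and \<phi>: "\<phi> \<in> GammaL2" "\<phi> ` range (\<lambda>y. vector [h\<^sub>1 y, y]) \<subseteq> range (\<lambda>y. vector [h\<^sub>2 y, y])"
      "\<phi> ` vec.span {vector [0, 1]} = vec.span {vector [0, 1]}"
  shows "\<exists>\<psi>\<in>GammaL2. \<psi> ` range (\<lambda>l. vector [\<kappa> (h\<^sub>1 (\<pi>\<^sub>1 l)), l]) =
    range (\<lambda>l. vector [\<kappa> (h\<^sub>2 (\<pi>\<^sub>2 l)), l])"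
proof -
  obtain \<alpha> \<beta> \<gamma> \<delta> \<rho> where det: "\<alpha> * \<delta> - \<beta> * \<gamma> \<noteq> 0" and \<rho>: "field_automorphism \<rho>"
    and \<phi>_def: "\<phi> = (\<lambda>v. vector [\<alpha> * \<rho> (v $ 1) + \<beta> * \<rho> (v $ 2), \<gamma> * \<rho> (v $ 1) + \<delta> * \<rho> (v $ 2)])"
    using \<phi>(1) unfolding mem_GammaL2_iff by blast
  have \<rho>_emb: "field_embedding \<rho>"
    using \<rho> by (simp add: field_automorphism_def)
  note \<rho>_simps = field_embedding_simps[OF \<rho>_emb]
  have "\<phi> (vector [0, 1]) \<in> vec.span {vector [0, 1]}"
    using \<phi>(3) vec.span_base[of "vector [0, 1]" "{vector [0, 1]}"] by blast
  then have "\<beta> = 0"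
    by (simp add: span_vertical \<phi>_def \<rho>_simps)
  with det have "\<alpha> \<noteq> 0" "\<delta> \<noteq> 0" by auto
  have h: "\<alpha> * \<rho> (h\<^sub>1 y) = h\<^sub>2 (\<gamma> * \<rho> (h\<^sub>1 y) + \<delta> * \<rho> y)" for y
  proof -
    have "\<phi> (vector [h\<^sub>1 y, y]) \<in> range (\<lambda>y. vector [h\<^sub>2 y, y])"
      using \<phi>(2) by blast
    then show ?thesis
      by (auto simp: \<phi>_def \<open>\<beta> = 0\<close> vec_eq_iff forall_2)
  qed
  obtain \<sigma> where \<sigma>: "field_automorphism \<sigma>" "\<And>x. \<sigma> (\<kappa> x) = \<kappa> (\<rho> x)"
    using field_automorphism_extends[OF \<kappa> \<rho>] by blast
  have \<sigma>_emb: "field_embedding \<sigma>" and bij: "bij \<sigma>" "bij \<rho>"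
    using \<sigma>(1) \<rho> by (auto simp: field_automorphism_def)
  note \<sigma>_simps = field_embedding_simps[OF \<sigma>_emb]
  \<comment> \<open>The functional l \<mapsto> \<delta> \<rho> (\<open>\<pi>\<^sub>1\<close> l) is
    only semilinear; composing it with the inverse of \<sigma> makes it F-linear because \<sigma>
    extends \<rho>.\<close>
  define \<eta> where "\<eta> l = \<delta> * \<rho> (\<pi>\<^sub>1 (the_inv \<sigma> l))" for l
  have inv: "the_inv \<sigma> (\<sigma> l) = l" for l
    using bij by (simp add: bij_def the_inv_f_f)
  have \<eta>: "\<eta> (\<sigma> l) = \<delta> * \<rho> (\<pi>\<^sub>1 l)" for l
    by (simp add: \<eta>_def inv)
  have "functional_over \<kappa> \<eta>"
    unfolding functional_over_def
  proof (intro conjI allI)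
    fix k l
    obtain k' l' where kl: "k = \<sigma> k'" "l = \<sigma> l'"
      using bij by (meson bij_pointE)
    show "\<eta> (k + l) = \<eta> k + \<eta> l"
      unfolding kl by (simp add: \<eta> \<rho>_simps functional_over_simps[OF \<pi>\<^sub>1(1)] distrib_left flip: \<sigma>_simps)
  next
    fix c l
    obtain c' l' where cl: "c = \<rho> c'" "l = \<sigma> l'"
      using bij by (meson bij_pointE)
    show "\<eta> (\<kappa> c * l) = c * \<eta> l"
      unfolding cl by (simp add: \<eta> \<rho>_simps functional_over_simps[OF \<pi>\<^sub>1(1)] mult_ac flip: \<sigma>_simps \<sigma>(2))
  qed
  then obtain d where "\<And>l. \<eta> l = \<pi>\<^sub>2 (d * l)"
    using dual by blast
  then have d: "\<pi>\<^sub>2 (d * \<sigma> l) = \<delta> * \<rho> (\<pi>\<^sub>1 l)" for l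
    by (metis \<eta>)
  \<comment> \<open>At l = 1 the defining property of \<open>d\<close> reads
    \<open>\<pi>\<^sub>2 d = \<delta>\<close>.\<close>
  have "d \<noteq> 0"
    using d[of 1] \<open>\<delta> \<noteq> 0\<close> by (auto simp: \<pi>\<^sub>1 \<rho>_simps functional_over_simps[OF \<pi>\<^sub>2(1)])
  define \<psi> :: "'l ^ 2 \<Rightarrow> 'l ^ 2" where
    "\<psi> = (\<lambda>v. vector [\<kappa> \<alpha> * \<sigma> (v $ 1) + 0 * \<sigma> (v $ 2), \<kappa> \<gamma> * \<sigma> (v $ 1) + d * \<sigma> (v $ 2)])"
  have \<psi>: "\<psi> \<in> GammaL2"
    unfolding mem_GammaL2_iff
  proof (intro exI conjI)
    show "\<kappa> \<alpha> * d - 0 * \<kappa> \<gamma> \<noteq> 0"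
      using \<open>d \<noteq> 0\<close> \<open>\<alpha> \<noteq> 0\<close> by (simp add: field_embedding_eq_0_iff[OF \<kappa>])
    show "\<psi> = (\<lambda>v. vector [\<kappa> \<alpha> * \<sigma> (v $ 1) + 0 * \<sigma> (v $ 2), \<kappa> \<gamma> * \<sigma> (v $ 1) + d * \<sigma> (v $ 2)])"
      by (fact \<psi>_def)
  qed (fact \<sigma>(1))
  have "\<psi> ` range (\<lambda>l. vector [\<kappa> (h\<^sub>1 (\<pi>\<^sub>1 l)), l]) = range (\<lambda>l. vector [\<kappa> (h\<^sub>2 (\<pi>\<^sub>2 l)), l])"
  proof (rule GammaL2_image_eqI[OF \<psi>])
    have "\<psi> (vector [\<kappa> (h\<^sub>1 (\<pi>\<^sub>1 l)), l]) =
        (\<lambda>l. vector [\<kappa> (h\<^sub>2 (\<pi>\<^sub>2 l)), l]) (\<kappa> (\<gamma> * \<rho> (h\<^sub>1 (\<pi>\<^sub>1 l))) + d * \<sigma> l)" for l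
    proof -
      \<comment> \<open>The explicit factor 1 puts the first summand into the shape of the scaling
        rule for \<open>\<pi>\<^sub>2\<close>.\<close>
      have "\<pi>\<^sub>2 (\<kappa> (\<gamma> * \<rho> (h\<^sub>1 (\<pi>\<^sub>1 l))) * 1 + d * \<sigma> l) = \<gamma> * \<rho> (h\<^sub>1 (\<pi>\<^sub>1 l)) + \<delta> * \<rho> (\<pi>\<^sub>1 l)"
        unfolding functional_over_simps[OF \<pi>\<^sub>2(1)] \<pi>\<^sub>2(2) d by simp
      then show ?thesis
        by (simp add: \<psi>_def vec_eq_iff forall_2 \<sigma>(2) field_embedding_simps(4)[OF \<kappa>] flip: h)
    qed
    then show "\<psi> ` range (\<lambda>l. vector [\<kappa> (h\<^sub>1 (\<pi>\<^sub>1 l)), l]) \<subseteq> range (\<lambda>l. vector [\<kappa> (h\<^sub>2 (\<pi>\<^sub>2 l)), l])"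
      by blast
  qed (simp add: card_range_graph[of "\<lambda>l. \<kappa> (h\<^sub>1 (\<pi>\<^sub>1 l))"] card_range_graph[of "\<lambda>l. \<kappa> (h\<^sub>2 (\<pi>\<^sub>2 l))"])
  then show ?thesis
    using \<psi> by blast
qed

text \<open>Scatteredness enters only through the bound \<open>N\<close>, which will be q:
  \<open>h\<^sub>2_ker\<close> bounds the vectors of the second graph over F on the vertical line,
  and \<open>h\<^sub>2_eig\<close> those on each other line through the origin.\<close>

lemma equivalence_restricts:
  fixes \<kappa> :: "'m::{field,finite} \<Rightarrow> 'l::{field,finite}"
  assumes \<kappa>: "field_embedding \<kappa>" and proper: "CARD('m) < CARD('l)"
    and \<pi>\<^sub>1: "functional_over \<kappa> \<pi>\<^sub>1" "\<pi>\<^sub>1 1 = 1"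
    and \<pi>\<^sub>2: "functional_over \<kappa> \<pi>\<^sub>2" "\<pi>\<^sub>2 1 = 1"
    and N: "N < CARD('m)" and "h\<^sub>1 0 = 0"
    and h\<^sub>1_ker: "card {y. h\<^sub>1 y = 0} \<le> N" and h\<^sub>2_ker: "card {y. h\<^sub>2 y = 0} \<le> N"
    and h\<^sub>2_eig: "\<And>m. card {y. y = m * h\<^sub>2 y} \<le> N"
    and \<phi>: "\<phi> \<in> GammaL2"
      "\<phi> ` range (\<lambda>l. vector [\<kappa> (h\<^sub>1 (\<pi>\<^sub>1 l)), l]) \<subseteq> range (\<lambda>l. vector [\<kappa> (h\<^sub>2 (\<pi>\<^sub>2 l)), l])"
  shows "\<exists>\<psi>\<in>GammaL2. \<psi> ` range (\<lambda>y. vector [h\<^sub>1 y, y]) = range (\<lambda>y. vector [h\<^sub>2 y, y]) \<and>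
    \<psi> ` vec.span {vector [0, 1]} = vec.span {vector [0, 1]}"
proof -
  note \<kappa>_simps = field_embedding_simps[OF \<kappa>]
  note inj_\<kappa> = inj_field_embedding[OF \<kappa>]
  note \<pi>\<^sub>1_simps = functional_over_simps[OF \<pi>\<^sub>1(1)] \<pi>\<^sub>1(2)
  note \<pi>\<^sub>2_simps = functional_over_simps[OF \<pi>\<^sub>2(1)] \<pi>\<^sub>2(2)
  have \<pi>_\<kappa>: "\<pi>\<^sub>1 (\<kappa> c) = c" "\<pi>\<^sub>2 (\<kappa> c) = c" for c
    using \<pi>\<^sub>1_simps(2)[of c 1] \<pi>\<^sub>2_simps(2)[of c 1] \<pi>\<^sub>1(2) \<pi>\<^sub>2(2) by simp_all
  obtain \<alpha> \<beta> \<gamma> \<delta> \<sigma> where det: "\<alpha> * \<delta> - \<beta> * \<gamma> \<noteq> 0" and \<sigma>: "field_automorphism \<sigma>"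
    and \<phi>_def: "\<phi> = (\<lambda>v. vector [\<alpha> * \<sigma> (v $ 1) + \<beta> * \<sigma> (v $ 2), \<gamma> * \<sigma> (v $ 1) + \<delta> * \<sigma> (v $ 2)])"
    using \<phi>(1) unfolding mem_GammaL2_iff by blast
  obtain \<rho> where \<rho>: "field_automorphism \<rho>" "\<And>x. \<sigma> (\<kappa> x) = \<kappa> (\<rho> x)"
    using field_automorphism_restricts[OF \<kappa> \<sigma>] by blast
  have \<sigma>_emb: "field_embedding \<sigma>" and \<rho>_emb: "field_embedding \<rho>" and bij: "bij \<sigma>" "bij \<rho>"
    using \<sigma> \<rho> by (auto simp: field_automorphism_def)
  note \<sigma>_simps = field_embedding_simps[OF \<sigma>_emb] and \<rho>_simps = field_embedding_simps[OF \<rho>_emb]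
  have U: "\<alpha> * \<kappa> (\<rho> (h\<^sub>1 (\<pi>\<^sub>1 l))) + \<beta> * \<sigma> l = \<kappa> (h\<^sub>2 (\<pi>\<^sub>2 (\<gamma> * \<kappa> (\<rho> (h\<^sub>1 (\<pi>\<^sub>1 l))) + \<delta> * \<sigma> l)))" for l
  proof -
    have "\<phi> (vector [\<kappa> (h\<^sub>1 (\<pi>\<^sub>1 l)), l]) \<in> range (\<lambda>l. vector [\<kappa> (h\<^sub>2 (\<pi>\<^sub>2 l)), l])"
      using \<phi>(2) by blast
    then show ?thesis
      by (auto simp: \<phi>_def \<rho>(2) vec_eq_iff forall_2)
  qed
  have U_ker: "\<beta> * \<sigma> l = \<kappa> (h\<^sub>2 (\<pi>\<^sub>2 (\<delta> * \<sigma> l)))" if "\<pi>\<^sub>1 l = 0" for l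
    using U[of l] that by (simp add: \<open>h\<^sub>1 0 = 0\<close> \<rho>_simps \<kappa>_simps)
  have nonzero: "\<exists>y. h y \<noteq> 0" if "card {y. h y = 0} \<le> N" for h :: "'m \<Rightarrow> 'm"
    using that N by (metis (mono_tags, lifting) Collect_cong UNIV_def not_le)

  have ker_large: "CARD('m) \<le> card {l. \<pi>\<^sub>1 l = 0}"
  proof -
    have "\<kappa> ` UNIV \<noteq> UNIV"
      using card_image_le[of UNIV \<kappa>] proper by auto
    then obtain l where l: "l \<notin> range \<kappa>" by blast
    \<comment> \<open>Removing the constant coordinate of an element outside F leaves a nonzero
      kernel element, and its F-multiples already number |F|.\<close>
    define w where "w = l - \<kappa> (\<pi>\<^sub>1 l)"
    have "w \<noteq> 0" "\<pi>\<^sub>1 w = 0"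
      using l by (auto simp: w_def \<pi>\<^sub>1_simps \<pi>_\<kappa>)
    show ?thesis
    proof (rule card_inj_on_le)
      show "inj (\<lambda>c. \<kappa> c * w)"
        using \<open>w \<noteq> 0\<close> inj_\<kappa> by (auto simp: inj_def)
      show "range (\<lambda>c. \<kappa> c * w) \<subseteq> {l. \<pi>\<^sub>1 l = 0}"
        using \<open>\<pi>\<^sub>1 w = 0\<close> by (auto simp: \<pi>\<^sub>1_simps)
    qed simp
  qed
  have "\<beta> = 0"
  proof (rule ccontr)
    assume "\<beta> \<noteq> 0"
    \<comment> \<open>For l in the kernel of \<open>\<pi>\<^sub>1\<close> and
      \<open>y = \<pi>\<^sub>2 (\<delta> * \<sigma> l)\<close>, \<open>U_ker\<close> gives
      \<open>\<beta> * \<sigma> l = \<kappa> (h\<^sub>2 y)\<close>. Multiplying by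
      \<open>\<delta> / \<beta>\<close> and applying \<open>\<pi>\<^sub>2\<close> yields
      \<open>y = ?m * h\<^sub>2 y\<close>, and y determines l. The kernel would thus have at most
      \<open>N\<close> elements.\<close>
    let ?m = "\<pi>\<^sub>2 (\<delta> / \<beta>)"
    have "card {l. \<pi>\<^sub>1 l = 0} \<le> card {y. y = ?m * h\<^sub>2 y}"
    proof (rule card_inj_on_le)
      show "inj_on (\<lambda>l. \<pi>\<^sub>2 (\<delta> * \<sigma> l)) {l. \<pi>\<^sub>1 l = 0}"
      proof (rule inj_onI)
        fix k l assume "k \<in> {l. \<pi>\<^sub>1 l = 0}" "l \<in> {l. \<pi>\<^sub>1 l = 0}" "\<pi>\<^sub>2 (\<delta> * \<sigma> k) = \<pi>\<^sub>2 (\<delta> * \<sigma> l)"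
        then have "\<beta> * \<sigma> k = \<beta> * \<sigma> l"
          by (simp add: U_ker)
        then show "k = l"
          using \<open>\<beta> \<noteq> 0\<close> inj_field_embedding[OF \<sigma>_emb] by (simp add: inj_eq)
      qed
      show "(\<lambda>l. \<pi>\<^sub>2 (\<delta> * \<sigma> l)) ` {l. \<pi>\<^sub>1 l = 0} \<subseteq> {y. y = ?m * h\<^sub>2 y}"
      proof safe
        fix l assume "\<pi>\<^sub>1 l = 0"
        have "\<delta> * \<sigma> l = \<delta> / \<beta> * (\<beta> * \<sigma> l)"
          using \<open>\<beta> \<noteq> 0\<close> by simp
        also have "\<dots> = \<delta> / \<beta> * \<kappa> (h\<^sub>2 (\<pi>\<^sub>2 (\<delta> * \<sigma> l)))"
          by (simp only: U_ker[OF \<open>\<pi>\<^sub>1 l = 0\<close>])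
        finally have "\<pi>\<^sub>2 (\<delta> * \<sigma> l) = \<pi>\<^sub>2 (\<delta> / \<beta> * \<kappa> (h\<^sub>2 (\<pi>\<^sub>2 (\<delta> * \<sigma> l))))"
          by (rule arg_cong)
        also have "\<dots> = ?m * h\<^sub>2 (\<pi>\<^sub>2 (\<delta> * \<sigma> l))"
          by (simp only: \<pi>\<^sub>2_simps(3) mult.commute)
        finally show "\<pi>\<^sub>2 (\<delta> * \<sigma> l) = ?m * h\<^sub>2 (\<pi>\<^sub>2 (\<delta> * \<sigma> l))" .
      qed
    qed simp
    then show False
      using ker_large h\<^sub>2_eig[of ?m] N by linarith
  qed
  with det have "\<alpha> \<noteq> 0" "\<delta> \<noteq> 0" by auto

  have \<delta>_ker: "\<pi>\<^sub>2 (\<delta> * \<sigma> l) = 0" if "\<pi>\<^sub>1 l = 0" for l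
  proof (rule ccontr)
    assume nz: "\<pi>\<^sub>2 (\<delta> * \<sigma> l) \<noteq> 0"
    obtain y where y: "h\<^sub>2 y \<noteq> 0"
      using nonzero[OF h\<^sub>2_ker] by blast
    \<comment> \<open>Scaling l by \<open>c\<close> stays in the kernel of
      \<open>\<pi>\<^sub>1\<close> and moves the nonzero value to a point where
      \<open>h\<^sub>2\<close> does not vanish, contradicting \<open>U_ker\<close> with
      \<open>\<beta> = 0\<close>.\<close>
    obtain c where c: "\<rho> c = y / \<pi>\<^sub>2 (\<delta> * \<sigma> l)"
      using bij by (metis bij_pointE)
    have "\<delta> * \<sigma> (\<kappa> c * l) = \<kappa> (\<rho> c) * (\<delta> * \<sigma> l)"
      by (simp add: \<sigma>_simps \<rho>(2))
    then have "\<pi>\<^sub>2 (\<delta> * \<sigma> (\<kappa> c * l)) = y"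
      using nz by (metis \<pi>\<^sub>2_simps(2) c nonzero_divide_eq_eq)
    moreover have "\<pi>\<^sub>1 (\<kappa> c * l) = 0"
      using that by (simp add: \<pi>\<^sub>1_simps)
    ultimately have "\<kappa> (h\<^sub>2 y) = 0"
      using U_ker[of "\<kappa> c * l"] \<open>\<beta> = 0\<close> by simp
    then show False
      using y by (simp add: field_embedding_eq_0_iff[OF \<kappa>])
  qed
  have "\<pi>\<^sub>2 \<delta> \<noteq> 0"
  proof
    assume "\<pi>\<^sub>2 \<delta> = 0"
    \<comment> \<open>With this l, \<open>\<pi>\<^sub>2 (\<delta> * \<sigma> l)\<close> is 1.
      Splitting l into its constant coordinate and a kernel element shows that it is also a multiple
      of \<open>\<pi>\<^sub>2 \<delta>\<close>, hence 0.\<close>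
    obtain l where l: "\<sigma> l = inverse \<delta>"
      using bij by (metis bij_pointE)
    have "\<pi>\<^sub>2 (\<delta> * \<sigma> (l - \<kappa> (\<pi>\<^sub>1 l))) = 0"
      by (rule \<delta>_ker) (simp add: \<pi>\<^sub>1_simps \<pi>_\<kappa>)
    then have "\<pi>\<^sub>2 (\<delta> * \<sigma> l) = 0"
      using \<open>\<pi>\<^sub>2 \<delta> = 0\<close> by (simp add: \<sigma>_simps right_diff_distrib \<rho>(2) \<pi>\<^sub>2_simps)
    then show False
      using \<open>\<delta> \<noteq> 0\<close> by (simp add: l \<pi>\<^sub>2(2))
  qed

  have U_\<kappa>: "\<alpha> * \<kappa> (\<rho> (h\<^sub>1 y)) = \<kappa> (h\<^sub>2 (\<pi>\<^sub>2 \<gamma> * \<rho> (h\<^sub>1 y) + \<pi>\<^sub>2 \<delta> * \<rho> y))" for y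
    using U[of "\<kappa> y"] by (simp add: \<open>\<beta> = 0\<close> \<pi>_\<kappa> \<rho>(2) \<pi>\<^sub>2_simps mult.commute)
  obtain y where y: "h\<^sub>1 y \<noteq> 0"
    using nonzero[OF h\<^sub>1_ker] by blast
  then have "\<rho> (h\<^sub>1 y) \<noteq> 0"
    by (simp add: field_embedding_eq_0_iff[OF \<rho>_emb])
  \<comment> \<open>Solving \<open>U_\<kappa>\<close> for \<alpha> at a point with
    \<open>h\<^sub>1 y \<noteq> 0\<close> expresses it as a quotient of elements of F.\<close>
  define a where "a = h\<^sub>2 (\<pi>\<^sub>2 \<gamma> * \<rho> (h\<^sub>1 y) + \<pi>\<^sub>2 \<delta> * \<rho> y) * inverse (\<rho> (h\<^sub>1 y))"
  have "\<kappa> (\<rho> (h\<^sub>1 y)) * \<kappa> (inverse (\<rho> (h\<^sub>1 y))) = 1"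
    using \<open>\<rho> (h\<^sub>1 y) \<noteq> 0\<close> \<kappa>_simps(2) by (simp flip: \<kappa>_simps(4))
  then have \<alpha>: "\<alpha> = \<kappa> a"
    unfolding a_def \<kappa>_simps(4) U_\<kappa>[symmetric] by (simp add: mult.assoc)
  then have "a \<noteq> 0"
    using \<open>\<alpha> \<noteq> 0\<close> by (auto simp: \<kappa>_simps)
  have h: "a * \<rho> (h\<^sub>1 y) = h\<^sub>2 (\<pi>\<^sub>2 \<gamma> * \<rho> (h\<^sub>1 y) + \<pi>\<^sub>2 \<delta> * \<rho> y)" for y
    by (rule injD[OF inj_\<kappa>]) (simp only: \<kappa>_simps(4) U_\<kappa> flip: \<alpha>)

  define \<psi> :: "'m ^ 2 \<Rightarrow> 'm ^ 2" where
    "\<psi> = (\<lambda>v. vector [a * \<rho> (v $ 1) + 0 * \<rho> (v $ 2),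
    \<pi>\<^sub>2 \<gamma> * \<rho> (v $ 1) + \<pi>\<^sub>2 \<delta> * \<rho> (v $ 2)])"
  have \<psi>: "\<psi> \<in> GammaL2"
    unfolding mem_GammaL2_iff
  proof (intro exI conjI)
    show "a * \<pi>\<^sub>2 \<delta> - 0 * \<pi>\<^sub>2 \<gamma> \<noteq> 0"
      using \<open>a \<noteq> 0\<close> \<open>\<pi>\<^sub>2 \<delta> \<noteq> 0\<close> by simp
    show "\<psi> = (\<lambda>v. vector [a * \<rho> (v $ 1) + 0 * \<rho> (v $ 2), \<pi>\<^sub>2 \<gamma> * \<rho> (v $ 1) + \<pi>\<^sub>2 \<delta> * \<rho> (v $ 2)])"
      by (fact \<psi>_def)
  qed (fact \<rho>(1))
  have "\<psi> ` range (\<lambda>y. vector [h\<^sub>1 y, y]) = range (\<lambda>y. vector [h\<^sub>2 y, y])"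
  proof (rule GammaL2_image_eqI[OF \<psi>])
    have "\<psi> (vector [h\<^sub>1 y, y]) = (\<lambda>y. vector [h\<^sub>2 y, y]) (\<pi>\<^sub>2 \<gamma> * \<rho> (h\<^sub>1 y) + \<pi>\<^sub>2 \<delta> * \<rho> y)" for y
      by (simp add: \<psi>_def h)
    then show "\<psi> ` range (\<lambda>y. vector [h\<^sub>1 y, y]) \<subseteq> range (\<lambda>y. vector [h\<^sub>2 y, y])"
      by blast
  qed (simp add: card_range_graph)
  moreover have "\<psi> ` vec.span {vector [0, 1]} = vec.span {vector [0, 1]}"
    by (rule GammaL2_image_eqI[OF \<psi>]) (auto simp: span_vertical \<psi>_def \<rho>_simps)
  ultimately show ?thesis
    using \<psi> by blast
qed

section \<open>Scattered polynomials\<close>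

text \<open>A kernel of dimension at most 1 lies in the set of multiples of a single vector.\<close>

lemma scattered_card_le:
  fixes \<iota> :: "'k::{field,finite} \<Rightarrow> 'm::{field,finite}"
  assumes \<iota>: "field_embedding \<iota>" and "scattered \<iota> f"
  shows "card {x. poly f x = m * x} \<le> CARD('k)"
proof -
  interpret vector_space "ext_scale \<iota>"
    by (rule vector_space_ext_scale[OF \<iota>])
  let ?S = "{x. poly f x - m * x = 0}"
  obtain B where B: "B \<subseteq> ?S" "independent B" "?S \<subseteq> span B" "card B = dim ?S"
    using basis_exists by blast
  have "card B \<le> 1"
    using assms(2) B(4) by (simp add: scattered_def)
  then have "B = {} \<or> (\<exists>v. B = {v})"
    by (metis One_nat_def card_0_eq card_1_singletonE finite le_SucE le_zero_eq)
  then obtain v where "span B \<subseteq> span {v}"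
    by (metis empty_subsetI span_mono subset_refl)
  then have "?S \<subseteq> range (\<lambda>c. ext_scale \<iota> c v)"
    using B(3) by (simp add: span_singleton)
  then have "card ?S \<le> CARD('k)"
    by (rule surj_card_le[rotated]) simp
  then show ?thesis by simp
qed

text \<open>Put x = y / b. Then h y = 0 says f x = a x, and for nonzero m the equation y = m h y
  says f x = (a + b / m) x, so both sets inject into kernels controlled by scatteredness. For m = 0
  the second set is just {0}.\<close>

lemma scattered_shift_card_le:
  fixes \<iota> :: "'k::{field,finite} \<Rightarrow> 'm::{field,finite}" and a :: 'm
  assumes \<iota>: "field_embedding \<iota>" and f: "scattered \<iota> f" and "b \<noteq> 0"
  defines "h \<equiv> \<lambda>y. poly f (y / b) - a * (y / b)"
  shows "card {y. h y = 0} \<le> CARD('k)" "card {y. y = m * h y} \<le> CARD('k)"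
proof -
  have inj: "inj_on (\<lambda>y. y / b) A" for A
    using \<open>b \<noteq> 0\<close> by (auto simp: inj_on_def)
  have "card {y. h y = 0} \<le> card {x. poly f x = a * x}"
    by (rule card_inj_on_le[OF inj]) (auto simp: h_def)
  then show "card {y. h y = 0} \<le> CARD('k)"
    using scattered_card_le[OF \<iota> f, of a] by linarith
  show "card {y. y = m * h y} \<le> CARD('k)"
  proof (cases "m = 0")
    case True
    then show ?thesis by (simp add: Suc_le_eq)
  next
    case False
    have "card {y. y = m * h y} \<le> card {x. poly f x = (a + b / m) * x}"
    proof (rule card_inj_on_le[OF inj])
      show "(\<lambda>y. y / b) ` {y. y = m * h y} \<subseteq> {x. poly f x = (a + b / m) * x}"
      proof safe
        fix y assume "y = m * h y"
        then have "poly f (y / b) - a * (y / b) = y / m"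
          using False by (simp add: h_def eq_divide_eq mult.commute)
        then show "poly f (y / b) = (a + b / m) * (y / b)"
          using \<open>b \<noteq> 0\<close> by (simp add: algebra_simps)
      qed
    qed simp
    then show ?thesis
      using scattered_card_le[OF \<iota> f, of "a + b / m"] by linarith
  qed
qed

lemma q_polynomial_at_0:
  assumes "f \<in> q_polynomials q" "q > 0"
  shows "poly f 0 = 0"
  using assms by (auto simp: q_polynomials_def poly_sum poly_monom power_0_left)

section \<open>The two kinds of spaces as graphs over their second coordinate\<close>

lemma Ubar_space_eq_graph:
  fixes b :: "'a::field"
  assumes "b \<noteq> 0"
  shows "Ubar_space f a b = range (\<lambda>y. vector [poly f (y / b) - a * (y / b), y])"
proof (intro equalityI subsetI)
  fix v :: "'a ^ 2" assume "v \<in> Ubar_space f a b"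
  then obtain x where "v = vector [poly f x - a * x, b * x]"
    by (auto simp: Ubar_space_def)
  then show "v \<in> range (\<lambda>y. vector [poly f (y / b) - a * (y / b), y])"
    using assms by (intro range_eqI[of _ _ "b * x"]) simp
next
  fix v :: "'a ^ 2" assume "v \<in> range (\<lambda>y. vector [poly f (y / b) - a * (y / b), y])"
  then obtain y where "v = vector [poly f (y / b) - a * (y / b), b * (y / b)]"
    using assms by auto
  then show "v \<in> Ubar_space f a b"
    unfolding Ubar_space_def by blast
qed

lemma U_space_eq_graph:
  fixes \<kappa> :: "'m::field \<Rightarrow> 'l::field"
  assumes "b \<noteq> 0" "r > 0"
    and \<pi>: "\<And>x. \<pi> (\<Sum>i<r. \<kappa> (x i) * \<omega> ^ i) = x 0"
    and span: "\<And>l. \<exists>x. l = (\<Sum>i<r. \<kappa> (x i) * \<omega> ^ i)"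
  shows "U_space \<kappa> r f a b \<omega> =
    range (\<lambda>l. vector [\<kappa> (poly f (\<pi> l / b) - a * (\<pi> l / b)), l])"
proof -
  have sum: "(\<Sum>i<r. \<kappa> (x i) * \<omega> ^ i) = \<kappa> (x 0) + (\<Sum>i = 1..r - 1. \<kappa> (x i) * \<omega> ^ i)" for x
  proof -
    have "{..<r} = insert 0 {1..r - 1}"
      using \<open>r > 0\<close> by auto
    then show ?thesis by simp
  qed
  have tail: "(\<Sum>i = 1..r - 1. \<kappa> ((x(0 := c)) i) * \<omega> ^ i) = (\<Sum>i = 1..r - 1. \<kappa> (x i) * \<omega> ^ i)" for x c
    by (intro sum.cong) auto
  show ?thesis
  proof (intro equalityI subsetI)
    fix v :: "'l ^ 2" assume "v \<in> U_space \<kappa> r f a b \<omega>"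
    then obtain x where v: "v = vector [\<kappa> (poly f (x 0) - a * x 0),
        \<kappa> (b * x 0) + (\<Sum>i = 1..r - 1. \<kappa> (x i) * \<omega> ^ i)]"
      by (auto simp: U_space_def)
    \<comment> \<open>The second entry of the vector has constant coordinate \<open>b * x 0\<close>,
      so applying \<pi> and dividing by b recovers \<open>x 0\<close>.\<close>
    let ?y = "x(0 := b * x 0)"
    have y: "(\<Sum>i<r. \<kappa> (?y i) * \<omega> ^ i) = \<kappa> (b * x 0) + (\<Sum>i = 1..r - 1. \<kappa> (x i) * \<omega> ^ i)"
      unfolding sum tail by simp
    show "v \<in> range (\<lambda>l. vector [\<kappa> (poly f (\<pi> l / b) - a * (\<pi> l / b)), l])"
      by (rule range_eqI[of _ _ "\<Sum>i<r. \<kappa> (?y i) * \<omega> ^ i"], unfold \<pi>, unfold y v)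
        (use \<open>b \<noteq> 0\<close> in simp)
  next
    fix v :: "'l ^ 2" assume "v \<in> range (\<lambda>l. vector [\<kappa> (poly f (\<pi> l / b) - a * (\<pi> l / b)), l])"
    then obtain l where v: "v = vector [\<kappa> (poly f (\<pi> l / b) - a * (\<pi> l / b)), l]"
      by blast
    obtain x where l: "l = (\<Sum>i<r. \<kappa> (x i) * \<omega> ^ i)"
      using span by blast
    let ?y = "x(0 := x 0 / b)"
    have "l = \<kappa> (b * ?y 0) + (\<Sum>i = 1..r - 1. \<kappa> (?y i) * \<omega> ^ i)"
      unfolding l sum tail using \<open>b \<noteq> 0\<close> by simp
    moreover have "\<pi> l / b = ?y 0"
      by (simp add: l \<pi>)
    ultimately show "v \<in> U_space \<kappa> r f a b \<omega>"
      unfolding v U_space_def by (intro CollectI exI[of _ ?y]) metis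
  qed
qed

theorem theorem4p1:
  fixes \<iota> :: "'k::{field,finite} \<Rightarrow> 'm::{field,finite}"
    and \<kappa> :: "'m \<Rightarrow> 'l::{field,finite}"
    and q n r t :: nat
    and f\<^sub>1 f\<^sub>2 :: "'m poly"
    and a\<^sub>1 a\<^sub>2 b\<^sub>1 b\<^sub>2 :: 'm
    and \<omega>\<^sub>1 \<omega>\<^sub>2 :: 'l
  assumes "primepow q"
    and "n = r * t" and "t > 1" and "r > 1"
    and "CARD('k) = q" and "CARD('m) = q ^ t" and "CARD('l) = q ^ n"
    and "field_embedding \<iota>" and "field_embedding \<kappa>"
    and "f\<^sub>1 \<in> q_polynomials q" and "f\<^sub>2 \<in> q_polynomials q"
    and "scattered \<iota> f\<^sub>1" and "scattered \<iota> f\<^sub>2"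
    and "b\<^sub>1 \<noteq> 0" and "b\<^sub>2 \<noteq> 0"
    and "basis_over \<kappa> ((\<lambda>i. \<omega>\<^sub>1 ^ i) ` {0..r - 1})"
    and "basis_over \<kappa> ((\<lambda>i. \<omega>\<^sub>2 ^ i) ` {0..r - 1})"
  shows "(\<exists>\<phi>\<in>GammaL2. \<phi> ` U_space \<kappa> r f\<^sub>1 a\<^sub>1 b\<^sub>1 \<omega>\<^sub>1 = U_space \<kappa> r f\<^sub>2 a\<^sub>2 b\<^sub>2 \<omega>\<^sub>2) \<longleftrightarrow>
         (\<exists>\<phi>\<in>GammaL2. \<phi> ` Ubar_space f\<^sub>1 a\<^sub>1 b\<^sub>1 = Ubar_space f\<^sub>2 a\<^sub>2 b\<^sub>2 \<and>
                       \<phi> ` vec.span {vector [0, 1]} = vec.span {vector [0, 1]})"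
proof -
  have "q > 1"
    using \<open>primepow q\<close> by (simp add: primepow_gt_Suc_0)
  have card: "CARD('l) = CARD('m) ^ r"
    using assms(2,6,7) by (simp add: power_mult mult.commute flip: power_mult)
  have "q ^ 1 < q ^ t"
    using \<open>q > 1\<close> \<open>t > 1\<close> by (rule power_strict_increasing[rotated])
  then have N: "CARD('k) < CARD('m)"
    using assms(5,6) by simp
  have "CARD('m) ^ 1 < CARD('m) ^ r"
    using N \<open>r > 1\<close> \<open>q > 1\<close> assms(5) by (intro power_strict_increasing) auto
  then have proper: "CARD('m) < CARD('l)"
    using card by simp
  have "r > 0" using \<open>r > 1\<close> by simp
  note \<iota> = \<open>field_embedding \<iota>\<close> and \<kappa> = \<open>field_embedding \<kappa>\<close>
  obtain \<pi>\<^sub>1 where \<pi>\<^sub>1: "functional_over \<kappa> \<pi>\<^sub>1" "\<And>x. \<pi>\<^sub>1 (\<Sum>i<r. \<kappa> (x i) * \<omega>\<^sub>1 ^ i) = x 0"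
    "\<And>l. \<exists>x. l = (\<Sum>i<r. \<kappa> (x i) * \<omega>\<^sub>1 ^ i)"
    using basis_over_constant_coordinate[OF \<kappa> card \<open>r > 0\<close> assms(16)] by blast
  obtain \<pi>\<^sub>2 where \<pi>\<^sub>2: "functional_over \<kappa> \<pi>\<^sub>2" "\<And>x. \<pi>\<^sub>2 (\<Sum>i<r. \<kappa> (x i) * \<omega>\<^sub>2 ^ i) = x 0"
    "\<And>l. \<exists>x. l = (\<Sum>i<r. \<kappa> (x i) * \<omega>\<^sub>2 ^ i)"
    using basis_over_constant_coordinate[OF \<kappa> card \<open>r > 0\<close> assms(17)] by blast
  \<comment> \<open>The coordinates of 1 in the power basis, used to normalise both
    functionals.\<close>
  have one: "(\<Sum>i<r. \<kappa> (of_bool (i = 0)) * \<omega> ^ i) = 1" for \<omega> :: 'l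
  proof -
    have "(\<Sum>i<r. \<kappa> (of_bool (i = 0)) * \<omega> ^ i) = (\<Sum>i<r. if i = 0 then 1 else 0)"
      by (intro sum.cong) (auto simp: field_embedding_simps[OF \<kappa>])
    then show ?thesis using \<open>r > 0\<close> by simp
  qed
  have \<pi>_1: "\<pi>\<^sub>1 1 = 1" "\<pi>\<^sub>2 1 = 1"
    using \<pi>\<^sub>1(2)[of "\<lambda>i. of_bool (i = 0)"] \<pi>\<^sub>2(2)[of "\<lambda>i. of_bool (i = 0)"] by (simp_all add: one)
  have dual: "\<exists>c. \<forall>l. \<eta> l = \<pi>\<^sub>2 (c * l)" if "functional_over \<kappa> \<eta>" for \<eta>
    using functional_over_eq_mult[OF \<pi>\<^sub>2(3) card \<pi>\<^sub>2(1) _ that] \<pi>_1 by (metis one_neq_zero)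
  define h\<^sub>1 where "h\<^sub>1 y = poly f\<^sub>1 (y / b\<^sub>1) - a\<^sub>1 * (y / b\<^sub>1)" for y
  define h\<^sub>2 where "h\<^sub>2 y = poly f\<^sub>2 (y / b\<^sub>2) - a\<^sub>2 * (y / b\<^sub>2)" for y
  have "h\<^sub>1 0 = 0"
    using q_polynomial_at_0[of f\<^sub>1 q] assms(10) \<open>q > 1\<close> by (simp add: h\<^sub>1_def)
  have bounds: "card {y. h\<^sub>1 y = 0} \<le> CARD('k)" "card {y. h\<^sub>2 y = 0} \<le> CARD('k)"
    "card {y. y = m * h\<^sub>2 y} \<le> CARD('k)" for m
    unfolding h\<^sub>1_def h\<^sub>2_def
    by (intro scattered_shift_card_le[OF \<iota>] assms)+
  note graphs = Ubar_space_eq_graph[OF \<open>b\<^sub>1 \<noteq> 0\<close>] Ubar_space_eq_graph[OF \<open>b\<^sub>2 \<noteq> 0\<close>]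
    U_space_eq_graph[where \<omega> = \<omega>\<^sub>1, OF \<open>b\<^sub>1 \<noteq> 0\<close> \<open>r > 0\<close> \<pi>\<^sub>1(2,3)]
    U_space_eq_graph[where \<omega> = \<omega>\<^sub>2, OF \<open>b\<^sub>2 \<noteq> 0\<close> \<open>r > 0\<close> \<pi>\<^sub>2(2,3)]
  show ?thesis
    unfolding graphs h\<^sub>1_def[symmetric] h\<^sub>2_def[symmetric]
  proof (rule iffI; elim bexE conjE)
    fix \<phi> :: "'l ^ 2 \<Rightarrow> 'l ^ 2"
    assume \<phi>: "\<phi> \<in> GammaL2" "\<phi> ` range (\<lambda>l. vector [\<kappa> (h\<^sub>1 (\<pi>\<^sub>1 l)), l]) =
      range (\<lambda>l. vector [\<kappa> (h\<^sub>2 (\<pi>\<^sub>2 l)), l])"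
    show "\<exists>\<psi>\<in>GammaL2. \<psi> ` range (\<lambda>y. vector [h\<^sub>1 y, y]) = range (\<lambda>y. vector [h\<^sub>2 y, y]) \<and>
        \<psi> ` vec.span {vector [0, 1]} = vec.span {vector [0, 1]}"
      by (rule equivalence_restricts[OF \<kappa> proper \<pi>\<^sub>1(1) \<pi>_1(1) \<pi>\<^sub>2(1) \<pi>_1(2) N \<open>h\<^sub>1 0 = 0\<close> bounds
        \<phi>(1) equalityD1[OF \<phi>(2)]])
  next
    fix \<phi> :: "'m ^ 2 \<Rightarrow> 'm ^ 2"
    assume \<phi>: "\<phi> \<in> GammaL2" "\<phi> ` range (\<lambda>y. vector [h\<^sub>1 y, y]) = range (\<lambda>y. vector [h\<^sub>2 y, y])"
      "\<phi> ` vec.span {vector [0, 1]} = vec.span {vector [0, 1]}"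
    show "\<exists>\<psi>\<in>GammaL2. \<psi> ` range (\<lambda>l. vector [\<kappa> (h\<^sub>1 (\<pi>\<^sub>1 l)), l]) =
        range (\<lambda>l. vector [\<kappa> (h\<^sub>2 (\<pi>\<^sub>2 l)), l])"
      by (rule equivalence_extends[OF \<kappa> \<pi>\<^sub>1(1) \<pi>_1(1) \<pi>\<^sub>2(1) \<pi>_1(2) dual \<phi>(1) equalityD1[OF \<phi>(2)] \<phi>(3)])
  qed
qed

end
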